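(* For every integer $k\ge 1$, $f(2,k)\le \frac{7}{4}k$.
   Context: An $r$-partite hypergraph is a hypergraph whose vertex set is partitioned into $r$ sides such that every edge contains exactly one vertex from each side (for $r=2$ this is a bipartite graph). A matching is a set of pairwise disjoint edges. Given (not necessarily distinct) sets of edges $F_1,\dots,F_k$, a rainbow matching is a choice of edges $e_1\in F_1,\dots,e_k\in F_k$ with $e_i\cap e_j=\emptyset$ for all $i\neq j$. For positive integers $r,k$, $f(r,k)$ denotes the least number $t$ such that every $k$ (not necessarily distinct) matchings of size $t$ in an $r$-partite hypergraph have a rainbow matching. *)

theory Defs
  imports Complex_Main "HOL-Library.Disjoint_Sets"
begin

text \<open>The sides \<open>S 0, \<dots>, S (r - 1)\<close> partition \<open>V\<close>; empty sides are allowed.\<close>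

definition partite_hypergraph ::
    "nat \<Rightarrow> 'v set \<Rightarrow> (nat \<Rightarrow> 'v set) \<Rightarrow> 'v set set \<Rightarrow> bool" where
  "partite_hypergraph r V S E \<longleftrightarrow>
     (\<Union>i<r. S i) = V \<and> disjoint_family_on S {..<r} \<and>
     (\<forall>e\<in>E. e \<subseteq> V \<and> (\<forall>i<r. \<exists>!v. v \<in> e \<inter> S i))"

definition matching_in :: "'v set set \<Rightarrow> 'v set set \<Rightarrow> bool" where
  "matching_in E M \<longleftrightarrow> M \<subseteq> E \<and> disjoint M"

definition rainbow_matching ::
    "nat \<Rightarrow> (nat \<Rightarrow> 'v set set) \<Rightarrow> (nat \<Rightarrow> 'v set) \<Rightarrow> bool" where
  "rainbow_matching k F e \<longleftrightarrow>
     (\<forall>i<k. e i \<in> F i) \<and> (\<forall>i<k. \<forall>j<k. i \<noteq> j \<longrightarrow> e i \<inter> e j = {})"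

text \<open>The finiteness condition is needed because \<open>card\<close> is 0 on infinite sets.\<close>

definition forces_rainbow :: "'v itself \<Rightarrow> nat \<Rightarrow> nat \<Rightarrow> nat \<Rightarrow> bool" where
  "forces_rainbow _ r k t \<longleftrightarrow>
     (\<forall>(V :: 'v set) S E F.
        partite_hypergraph r V S E \<and>
        (\<forall>i<k. matching_in E (F i) \<and> finite (F i) \<and> card (F i) = t) \<longrightarrow>
        (\<exists>e. rainbow_matching k F e))"

text \<open>Natural numbers serve as vertices. This is no restriction, since only finitely many vertices
  are covered by the given matchings; see \<open>forces_rainbow_any_type\<close>. The minimum is taken over a
  nonempty set by \<open>forces_rainbow_exists\<close>.\<close>

definition rainbow_number :: "nat \<Rightarrow> nat \<Rightarrow> nat" where
  "rainbow_number r k = (LEAST t. forces_rainbow TYPE(nat) r k t)"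

lemma partite_hypergraph_edge:
  assumes "partite_hypergraph r V S E" "e \<in> E"
  shows "finite e" "card e \<le> r"
proof -
  have "e \<subseteq> (\<Union>i<r. S i)"
    using assms unfolding partite_hypergraph_def by simp
  then have eq: "e = (\<Union>i<r. e \<inter> S i)"
    by blast
  have one: "\<exists>v. e \<inter> S i = {v}" if "i < r" for i
  proof -
    have "\<exists>!v. v \<in> e \<inter> S i"
      using assms that unfolding partite_hypergraph_def by simp
    then show ?thesis by blast
  qed
  have fin: "finite (e \<inter> S i)" and card: "card (e \<inter> S i) = 1" if "i < r" for i
    using one[OF that] by auto
  have "finite (\<Union>i<r. e \<inter> S i)"
    by (rule finite_UN_I) (use fin in simp_all)
  then show "finite e" using eq by simp
  have "card (\<Union>i<r. e \<inter> S i) \<le> (\<Sum>i<r. card (e \<inter> S i))"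
    by (rule card_UN_le) simp
  also have "\<dots> = r"
    using card by simp
  finally show "card e \<le> r" using eq by simp
qed

lemma disjoint_avoid:
  assumes "disjoint M" "finite U" "card U < card M"
  shows "\<exists>e\<in>M. e \<inter> U = {}"
proof (rule ccontr)
  assume "\<not> ?thesis"
  then have "\<forall>e\<in>M. \<exists>v. v \<in> e \<inter> U" by blast
  then obtain g where g: "\<forall>e\<in>M. g e \<in> e \<inter> U" by metis
  have "inj_on g M"
    using g assms(1) unfolding inj_on_def disjoint_def by (metis IntD1 IntI empty_iff)
  moreover have "g ` M \<subseteq> U" using g by blast
  ultimately have "card M \<le> card U" using assms(2) by (meson card_inj_on_le)
  then show False using assms(3) by simp
qed

lemma forces_rainbow_exists: "forces_rainbow TYPE('v) r k (r * k + 1)"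
  unfolding forces_rainbow_def
proof (intro allI impI)
  fix V :: "'v set" and S E F
  assume H: "partite_hypergraph r V S E \<and>
    (\<forall>i<k. matching_in E (F i) \<and> finite (F i) \<and> card (F i) = r * k + 1)"
  have "m \<le> k \<Longrightarrow> \<exists>e. rainbow_matching m F e" for m
  proof (induction m)
    case 0
    then show ?case by (simp add: rainbow_matching_def)
  next
    case (Suc m)
    then obtain e where e: "rainbow_matching m F e" by auto
    define U where "U = (\<Union>i<m. e i)"
    have mem: "e i \<in> E" if "i < m" for i
      using that e H Suc.prems unfolding rainbow_matching_def matching_in_def
      by (meson Suc_le_lessD less_trans subsetD)
    have fin: "finite U"
      unfolding U_def using mem H partite_hypergraph_edge(1) by blast
    have "card U \<le> (\<Sum>i<m. card (e i))"
      unfolding U_def by (rule card_UN_le) simp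
    also have "\<dots> \<le> (\<Sum>i<m. r)"
      by (rule sum_mono) (use mem H partite_hypergraph_edge(2) in blast)
    also have "\<dots> = m * r" by simp
    also have "\<dots> \<le> r * k" using Suc.prems by (simp add: mult.commute)
    finally have "card U < card (F m)" using H Suc.prems by simp
    moreover have "disjoint (F m)"
      using H Suc.prems by (simp add: matching_in_def)
    ultimately obtain d where d: "d \<in> F m" "d \<inter> U = {}"
      using disjoint_avoid fin by blast
    have dis: "d \<inter> e i = {}" if "i < m" for i
      using d that unfolding U_def by blast
    have "rainbow_matching (Suc m) F (e(m := d))"
      using e d(1) dis unfolding rainbow_matching_def
      by (auto simp: less_Suc_eq Int_commute)
    then show ?case by blast
  qed
  then show "\<exists>e. rainbow_matching k F e" by blast
qed

lemma forces_rainbow_any_type: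
  assumes "forces_rainbow TYPE(nat) r k t"
  shows "forces_rainbow TYPE('v) r k t"
  unfolding forces_rainbow_def
proof (intro allI impI)
  fix V :: "'v set" and S E F
  assume H: "partite_hypergraph r V S E \<and>
    (\<forall>i<k. matching_in E (F i) \<and> finite (F i) \<and> card (F i) = t)"
  define D where "D = (\<Union>i<k. F i)"
  define W where "W = \<Union>D"
  have DE: "D \<subseteq> E" using H unfolding D_def matching_in_def by blast
  have "finite D" unfolding D_def using H by blast
  then have "finite W"
    unfolding W_def using DE H partite_hypergraph_edge(1) by (meson finite_Union subsetD)
  then obtain g :: "'v \<Rightarrow> nat" where g: "inj_on g W"
    using finite_imp_inj_to_nat_seg by metis
  have FW: "d \<subseteq> W" if "i < k" "d \<in> F i" for i d
    using that unfolding W_def D_def by blast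
  have gint: "(g ` A) \<inter> (g ` B) = g ` (A \<inter> B)" if "A \<subseteq> W" "B \<subseteq> W" for A B
    using inj_on_image_Int[OF g that] by simp
  have WV: "W \<subseteq> V"
    using H DE unfolding W_def partite_hypergraph_def by blast
  have "partite_hypergraph r (g ` W) (\<lambda>i. g ` (S i \<inter> W)) ((`) g ` D)"
    unfolding partite_hypergraph_def
  proof (intro conjI ballI allI impI)
    have "W = (\<Union>i<r. S i \<inter> W)"
      using WV H unfolding partite_hypergraph_def by blast
    then show "(\<Union>i<r. g ` (S i \<inter> W)) = g ` W" by (metis image_UN)
    show "disjoint_family_on (\<lambda>i. g ` (S i \<inter> W)) {..<r}"
      unfolding disjoint_family_on_def
    proof (intro ballI impI)
      fix i j assume ij: "i \<in> {..<r}" "j \<in> {..<r}" "i \<noteq> j"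
      then have "S i \<inter> S j = {}"
        using H unfolding partite_hypergraph_def disjoint_family_on_def by blast
      then show "g ` (S i \<inter> W) \<inter> g ` (S j \<inter> W) = {}"
        by (subst gint) auto
    qed
  next
    fix e' assume "e' \<in> (`) g ` D"
    then show "e' \<subseteq> g ` W" unfolding W_def by blast
  next
    fix e' i assume e': "e' \<in> (`) g ` D" and i: "i < r"
    then obtain d where d: "d \<in> D" "e' = g ` d" by blast
    then have dW: "d \<subseteq> W" unfolding W_def by blast
    have "partite_hypergraph r V S E" "d \<in> E" using H DE d(1) by auto
    then have "\<exists>!v. v \<in> d \<inter> S i"
      using i unfolding partite_hypergraph_def by simp
    then obtain v where "d \<inter> S i = {v}" by blast
    then have "d \<inter> (S i \<inter> W) = {v}" using dW by blast
    then have "e' \<inter> g ` (S i \<inter> W) = {g v}"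
      using gint[OF dW, of "S i \<inter> W"] d(2) by simp
    then show "\<exists>!v. v \<in> e' \<inter> g ` (S i \<inter> W)" by simp
  qed
  moreover have "matching_in ((`) g ` D) ((`) g ` F i) \<and> finite ((`) g ` F i) \<and>
      card ((`) g ` F i) = t" if i: "i < k" for i
  proof -
    have F: "disjoint (F i)" "finite (F i)" "card (F i) = t"
      using H i by (auto simp: matching_in_def)
    have "inj_on ((`) g) (F i)"
      using inj_on_image_eq_iff[OF g] FW[OF i] by (meson inj_onI)
    moreover have "disjoint ((`) g ` F i)"
      unfolding disjoint_def
    proof (intro ballI impI)
      fix a b assume "a \<in> (`) g ` F i" "b \<in> (`) g ` F i" "a \<noteq> b"
      then obtain c d where "c \<in> F i" "d \<in> F i" "a = g ` c" "b = g ` d" "c \<noteq> d" by blast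
      then show "a \<inter> b = {}"
        using F(1) gint[OF FW[OF i] FW[OF i]] unfolding disjoint_def by auto
    qed
    moreover have "(`) g ` F i \<subseteq> (`) g ` D" using i unfolding D_def by blast
    ultimately show ?thesis using F by (simp add: matching_in_def card_image)
  qed
  ultimately obtain e' where e': "rainbow_matching k (\<lambda>i. (`) g ` F i) e'"
    using assms[unfolded forces_rainbow_def, rule_format,
        of "g ` W" "\<lambda>i. g ` (S i \<inter> W)" "(`) g ` D" "\<lambda>i. (`) g ` F i"] by auto
  have "\<forall>i. \<exists>d. i < k \<longrightarrow> d \<in> F i \<and> e' i = g ` d"
    using e' unfolding rainbow_matching_def by blast
  then obtain e where e: "\<And>i. i < k \<Longrightarrow> e i \<in> F i \<and> e' i = g ` e i" by metis
  have "e i \<inter> e j = {}" if "i < k" "j < k" "i \<noteq> j" for i j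
  proof -
    have "g ` e i \<inter> g ` e j = {}"
      using e' e that unfolding rainbow_matching_def by metis
    then show ?thesis by blast
  qed
  then have "rainbow_matching k F e"
    using e unfolding rainbow_matching_def by blast
  then show "\<exists>e. rainbow_matching k F e" by blast
qed

end

theory Submission
  imports Defs
begin

text \<open>By induction there is a rainbow matching \<open>(a i, b i)\<close>, \<open>i < N\<close>, of all matchings but the last
  one, \<open>M N\<close>. Put \<open>X = a ` {..<N}\<close> and \<open>Y = b ` {..<N}\<close>, and suppose that no rainbow matching
  of all \<open>N + 1\<close> matchings exists. Then \<open>M N\<close> has no edge avoiding both \<open>X\<close> and \<open>Y\<close>, so for at
  least \<open>s = n - N\<close> indices \<open>i\<close> it has an edge from \<open>a i\<close> to some \<open>y i \<notin> Y\<close>. For such \<open>i\<close>, giving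
  \<open>(a i, y i)\<close> to \<open>M N\<close> frees \<open>M i\<close>; hence every edge of \<open>M i\<close> that avoids \<open>Y\<close> and \<open>y i\<close> starts in
  \<open>X\<close>, and there are at least \<open>s - 1\<close> of them. Symmetrically, for at least \<open>s\<close> indices \<open>j\<close> there is
  an edge of \<open>M N\<close> from some \<open>x j \<notin> X\<close> to \<open>b j\<close>. Take \<open>s\<close> indices of each kind. For a pair
  \<open>(i, j)\<close>, it cannot happen that \<open>M i\<close> leaves \<open>a j\<close> to a vertex outside \<open>Y \<union> {y i}\<close> and \<open>M j\<close>
  leaves \<open>b i\<close> to a vertex outside \<open>X\<close>: these two edges and \<open>(a i, y i)\<close> could replace the edges
  of \<open>i\<close> and \<open>j\<close>. Counting pairs yields \<open>2 s (2 s - N - 1) \<le> s\<^sup>2\<close>, that is, \<open>3 n \<le> 5 N + 2\<close>. This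
  contradicts \<open>n \<ge> \<lfloor>5 (N + 1) / 3\<rfloor>\<close>, a weaker requirement than \<open>n \<ge> \<lfloor>7 (N + 1) / 4\<rfloor>\<close>.\<close>

section \<open>Bipartite matchings as sets of pairs\<close>

text \<open>With an edge encoded as the pair of its endpoints, disjointness of edges becomes
  injectivity of both projections, and swapping the sides is taking converses.\<close>

definition pair_matching :: "('a \<times> 'b) set \<Rightarrow> bool" where
  "pair_matching M \<longleftrightarrow> finite M \<and> inj_on fst M \<and> inj_on snd M"

text \<open>The index set is arbitrary because the exchanges below drop one or two indices and
  refill them one at a time.\<close>

definition pair_rainbow :: "('i \<Rightarrow> ('a \<times> 'b) set) \<Rightarrow> 'i set \<Rightarrow> ('i \<Rightarrow> 'a) \<Rightarrow> ('i \<Rightarrow> 'b) \<Rightarrow> bool" where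
  "pair_rainbow M I a b \<longleftrightarrow> (\<forall>i\<in>I. (a i, b i) \<in> M i) \<and> inj_on a I \<and> inj_on b I"

lemma pair_matching_converse: "pair_matching (M\<inverse>) \<longleftrightarrow> pair_matching M"
proof -
  have "inj_on fst (M\<inverse>) \<longleftrightarrow> inj_on snd M" "inj_on snd (M\<inverse>) \<longleftrightarrow> inj_on fst M"
    by (auto simp: inj_on_def Ball_def)
  then show ?thesis unfolding pair_matching_def by auto
qed

lemma pair_rainbow_converse:
  "pair_rainbow (\<lambda>i. (M i)\<inverse>) I b a \<longleftrightarrow> pair_rainbow M I a b"
  unfolding pair_rainbow_def by auto

lemma pair_rainbow_subset: "pair_rainbow M I a b \<Longrightarrow> J \<subseteq> I \<Longrightarrow> pair_rainbow M J a b"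
  unfolding pair_rainbow_def by (meson inj_on_subset subsetD)

lemma pair_rainbow_insert:
  assumes "pair_rainbow M I a b" "i \<notin> I" "(x, y) \<in> M i" "x \<notin> a ` I" "y \<notin> b ` I"
  shows "pair_rainbow M (insert i I) (a(i := x)) (b(i := y))"
  using assms unfolding pair_rainbow_def by (auto simp: inj_on_def)

text \<open>Edges ending in \<open>W\<close> inject into \<open>W\<close> by \<open>snd\<close>; the
  others inject by \<open>fst\<close> into the vertices \<open>a j\<close> with \<open>j\<close> in
  the set counted on the right.\<close>

lemma card_pair_matching_le:
  assumes M: "pair_matching M" and fin: "finite W" "finite I"
    and cover: "\<And>x y. (x, y) \<in> M \<Longrightarrow> y \<notin> W \<Longrightarrow> x \<in> a ` I"
  shows "card M \<le> card W + card {j\<in>I. \<exists>y. (a j, y) \<in> M \<and> y \<notin> W}"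
    (is "_ \<le> _ + card ?J")
proof -
  let ?P = "{e\<in>M. snd e \<in> W}" and ?Q = "{e\<in>M. snd e \<notin> W}"
  have "inj_on snd ?P" "inj_on fst ?Q"
    using M unfolding pair_matching_def by (auto intro: inj_on_subset)
  moreover have "snd ` ?P \<subseteq> W" by blast
  moreover have "fst ` ?Q \<subseteq> a ` ?J"
  proof
    fix x assume "x \<in> fst ` ?Q"
    then obtain y where "(x, y) \<in> M" "y \<notin> W" by auto
    with cover show "x \<in> a ` ?J" by blast
  qed
  ultimately have "card ?P \<le> card W" "card ?Q \<le> card (a ` ?J)"
    using fin by (auto intro!: card_inj_on_le)
  moreover have "card (a ` ?J) \<le> card ?J"
    using fin by (intro card_image_le) simp
  moreover have "card M = card ?P + card ?Q"
    using M unfolding pair_matching_def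
    by (subst card_Un_disjoint[symmetric]) (auto intro: arg_cong[where f = card])
  ultimately show ?thesis by linarith
qed

section \<open>Exchange arguments\<close>

text \<open>An edge of \<open>M i\<close> avoiding \<open>a\<close> {..<N}\<open>,\<close>b
  \<open>{..<N}\<close> and \<open>y\<close> could replace the edge of \<open>i\<close>, leaving
  \<open>(a i, y)\<close> for \<open>N\<close>. So \<open>card_pair_matching_le\<close> applies with
  a set \<open>W\<close> of at most \<open>N + 1\<close> vertices.\<close>

lemma exchange_out_card:
  fixes a :: "nat \<Rightarrow> 'a" and b :: "nat \<Rightarrow> 'b"
  assumes R: "pair_rainbow M {..<N} a b"
    and no: "\<nexists>a b. pair_rainbow M {..N} a b"
    and M: "pair_matching (M i)"
    and i: "i < N" and y: "(a i, y) \<in> M N" "y \<notin> b ` {..<N}"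
  shows "card (M i) \<le> Suc N + card {j\<in>{..<N}. \<exists>z. (a j, z) \<in> M i \<and> z \<notin> insert y (b ` {..<N})}"
proof -
  let ?W = "insert y (b ` {..<N})"
  have "u \<in> a ` {..<N}" if uv: "(u, v) \<in> M i" "v \<notin> ?W" for u v
  proof (rule ccontr)
    assume u: "u \<notin> a ` {..<N}"
    let ?I = "{..<N} - {i}"
    have ai: "a i \<notin> a ` ?I"
      using R i unfolding pair_rainbow_def inj_on_def by auto
    have "pair_rainbow M ?I a b"
      using R by (rule pair_rainbow_subset) blast
    then have "pair_rainbow M (insert i ?I) (a(i := u)) (b(i := v))"
      by (rule pair_rainbow_insert) (use uv u in auto)
    then have "pair_rainbow M (insert N (insert i ?I)) (a(i := u, N := a i)) (b(i := v, N := y))"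
      by (rule pair_rainbow_insert) (use i y u uv ai in auto)
    moreover have "insert N (insert i ?I) = {..N}" using i by auto
    ultimately show False using no by metis
  qed
  then have "card (M i) \<le> card ?W + card {j\<in>{..<N}. \<exists>z. (a j, z) \<in> M i \<and> z \<notin> ?W}"
    using M by (intro card_pair_matching_le) auto
  moreover have "card ?W \<le> Suc N"
    using card_image_le[of "{..<N}" b] card_insert_le_m1[of "Suc N" "b ` {..<N}" y] by simp
  ultimately show ?thesis by linarith
qed

text \<open>Otherwise \<open>i\<close> could move to \<open>(a j, z)\<close>, \<open>j\<close> to
  \<open>(w, b i)\<close>, and \<open>N\<close> could take \<open>(a i, y)\<close>.\<close>

lemma no_crossing_exchange:
  fixes a :: "nat \<Rightarrow> 'a" and b :: "nat \<Rightarrow> 'b"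
  assumes R: "pair_rainbow M {..<N} a b"
    and no: "\<nexists>a b. pair_rainbow M {..N} a b"
    and M: "pair_matching (M i)"
    and ij: "i < N" "j < N" and y: "(a i, y) \<in> M N" "y \<notin> b ` {..<N}"
    and z: "(a j, z) \<in> M i" "z \<notin> insert y (b ` {..<N})"
    and w: "(w, b i) \<in> M j" "w \<notin> a ` {..<N}"
  shows False
proof -
  have "i \<noteq> j"
  proof
    assume "i = j"
    moreover have "(a i, b i) \<in> M i" using R ij unfolding pair_rainbow_def by simp
    ultimately have "z = b i"
      using M z unfolding pair_matching_def inj_on_def by fastforce
    then show False using z ij by blast
  qed
  let ?I = "{..<N} - {i, j}"
  have out: "a i \<notin> a ` ?I" "a j \<notin> a ` ?I" "b i \<notin> b ` ?I" "a i \<noteq> a j"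
    using R ij \<open>i \<noteq> j\<close> unfolding pair_rainbow_def inj_on_def by auto
  have "pair_rainbow M ?I a b"
    using R by (rule pair_rainbow_subset) blast
  then have "pair_rainbow M (insert i ?I) (a(i := a j)) (b(i := z))"
    by (rule pair_rainbow_insert) (use z out in auto)
  then have "pair_rainbow M (insert j (insert i ?I)) (a(i := a j, j := w)) (b(i := z, j := b i))"
    by (rule pair_rainbow_insert) (use z w out ij \<open>i \<noteq> j\<close> in auto)
  then have "pair_rainbow M (insert N (insert j (insert i ?I)))
      (a(i := a j, j := w, N := a i)) (b(i := z, j := b i, N := y))"
    by (rule pair_rainbow_insert) (use z w y out ij \<open>i \<noteq> j\<close> in auto)
  moreover have "insert N (insert j (insert i ?I)) = {..N}" using ij by auto
  ultimately show False using no by metis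
qed

section \<open>Double counting over pairs of indices\<close>

text \<open>Once the second sum is reordered to run over \<open>A\<close>, each \<open>i\<close>
  contributes two disjoint subsets of \<open>B\<close>.\<close>

lemma sum_card_exclusive_le:
  assumes "finite A" "finite B" and "\<And>i j. i \<in> A \<Longrightarrow> j \<in> B \<Longrightarrow> \<not> (P i j \<and> Q i j)"
  shows "(\<Sum>i\<in>A. card {j\<in>B. P i j}) + (\<Sum>j\<in>B. card {i\<in>A. Q i j}) \<le> card A * card B"
proof -
  have "(\<Sum>j\<in>B. card {i\<in>A. Q i j}) = (\<Sum>i\<in>A. card {j\<in>B. Q i j})"
    using assms(1,2) by (intro sum_multicount_gen[symmetric]) auto
  then have "(\<Sum>i\<in>A. card {j\<in>B. P i j}) + (\<Sum>j\<in>B. card {i\<in>A. Q i j}) =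
      (\<Sum>i\<in>A. card {j\<in>B. P i j} + card {j\<in>B. Q i j})"
    by (simp add: sum.distrib)
  also have "\<dots> \<le> (\<Sum>i\<in>A. card B)"
  proof (rule sum_mono)
    fix i assume i: "i \<in> A"
    have "card {j\<in>B. P i j} + card {j\<in>B. Q i j} = card ({j\<in>B. P i j} \<union> {j\<in>B. Q i j})"
      using assms i by (intro card_Un_disjoint[symmetric]) auto
    also have "\<dots> \<le> card B" using assms(2) by (intro card_mono) auto
    finally show "card {j\<in>B. P i j} + card {j\<in>B. Q i j} \<le> card B" .
  qed
  finally show ?thesis by simp
qed

lemma pair_rainbow_extend:
  fixes a :: "nat \<Rightarrow> 'a" and b :: "nat \<Rightarrow> 'b"
  assumes R: "pair_rainbow M {..<N} a b"
    and M: "\<And>i. i \<le> N \<Longrightarrow> pair_matching (M i)"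
    and n: "\<And>i. i \<le> N \<Longrightarrow> n \<le> card (M i)" and large: "5 * N + 3 \<le> 3 * n"
  shows "\<exists>a b. pair_rainbow M {..N} a b"
proof (rule ccontr)
  assume no: "\<not> ?thesis"
  let ?X = "a ` {..<N}" and ?Y = "b ` {..<N}"
  \<comment> \<open>Swapping the sides lets \<open>exchange_out_card\<close> serve the indices in
    \<open>B\<close> as well.\<close>
  have R': "pair_rainbow (\<lambda>i. (M i)\<inverse>) {..<N} b a"
    and no': "\<nexists>b a. pair_rainbow (\<lambda>i. (M i)\<inverse>) {..N} b a"
    using R no by (simp_all add: pair_rainbow_converse)
  have touch: "x \<in> ?X \<or> y \<in> ?Y" if "(x, y) \<in> M N" for x y
    using pair_rainbow_insert[OF R _ that] no
    by (auto simp flip: lessThan_Suc_atMost simp: lessThan_Suc)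
  have cXY: "card ?X \<le> N" "card ?Y \<le> N"
    using card_image_le[of "{..<N}"] by simp_all
  define GA where "GA = {i\<in>{..<N}. \<exists>y. (a i, y) \<in> M N \<and> y \<notin> ?Y}"
  define GB where "GB = {j\<in>{..<N}. \<exists>x. (b j, x) \<in> (M N)\<inverse> \<and> x \<notin> ?X}"
  have "card (M N) \<le> card ?Y + card GA"
    unfolding GA_def using touch M by (intro card_pair_matching_le) auto
  moreover have "card ((M N)\<inverse>) \<le> card ?X + card GB"
    unfolding GB_def using touch M
    by (intro card_pair_matching_le) (auto simp: pair_matching_converse)
  ultimately have "n - N \<le> card GA" "n - N \<le> card GB"
    using n[of N] cXY by simp_all
  then obtain A B where A: "A \<subseteq> GA" "card A = n - N" and B: "B \<subseteq> GB" "card B = n - N"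
    by (meson obtain_subset_with_card_n)
  have AN: "A \<subseteq> {..<N}" "B \<subseteq> {..<N}"
    using A B unfolding GA_def GB_def by auto
  then have fin: "finite A" "finite B" by (auto intro: finite_subset)
  have "\<forall>i\<in>A. \<exists>y. (a i, y) \<in> M N \<and> y \<notin> ?Y"
    using A(1) unfolding GA_def by blast
  from bchoice[OF this] obtain y
    where y: "\<And>i. i \<in> A \<Longrightarrow> (a i, y i) \<in> M N \<and> y i \<notin> ?Y" by blast
  have "\<forall>j\<in>B. \<exists>x. (b j, x) \<in> (M N)\<inverse> \<and> x \<notin> ?X"
    using B(1) unfolding GB_def by blast
  from bchoice[OF this] obtain x
    where x: "\<And>j. j \<in> B \<Longrightarrow> (b j, x j) \<in> (M N)\<inverse> \<and> x j \<notin> ?X" by blast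
  define P where "P i j \<longleftrightarrow> (\<exists>z. (a j, z) \<in> M i \<and> z \<notin> insert (y i) ?Y)" for i j
  define Q where "Q i j \<longleftrightarrow> (\<exists>z. (b i, z) \<in> (M j)\<inverse> \<and> z \<notin> insert (x j) ?X)" for i j
  \<comment> \<open>At most \<open>N - (n - N)\<close> indices below \<open>N\<close> lie outside
    \<open>T\<close>. This turns the bound \<open>n - N - 1\<close> from the exchange into
    \<open>2 * n - 3 * N - 1\<close>.\<close>
  have restrict: "card {j\<in>{..<N}. S j} + (n - N) \<le> card {j\<in>T. S j} + N"
    if "T \<subseteq> {..<N}" "card T = n - N" for S and T :: "nat set"
  proof -
    have T: "finite T" using that by (auto intro: finite_subset)
    have "card {j\<in>{..<N}. S j} + card T =
        card ({j\<in>{..<N}. S j} \<union> T) + card ({j\<in>{..<N}. S j} \<inter> T)"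
      using T by (intro card_Un_Int) auto
    moreover have "card ({j\<in>{..<N}. S j} \<union> T) \<le> card {..<N}"
      using that by (intro card_mono) auto
    moreover have "{j\<in>{..<N}. S j} \<inter> T = {j\<in>T. S j}" using that by auto
    ultimately show ?thesis using that by simp
  qed
  have lowP: "2 * n \<le> 3 * N + 1 + card {j\<in>B. P i j}" if "i \<in> A" for i
  proof -
    have i: "i < N" using that AN by auto
    have "card (M i) \<le> Suc N + card {j\<in>{..<N}. P i j}"
      unfolding P_def by (rule exchange_out_card[OF R no]) (use M i y[OF that] in auto)
    then show ?thesis
      using restrict[OF AN(2) B(2), of "P i"] n[of i] i large by linarith
  qed
  have lowQ: "2 * n \<le> 3 * N + 1 + card {i\<in>A. Q i j}" if "j \<in> B" for j
  proof -
    have j: "j < N" using that AN by auto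
    then have "pair_matching ((M j)\<inverse>)"
      using M by (auto simp: pair_matching_converse)
    then have "card ((M j)\<inverse>) \<le> Suc N + card {i\<in>{..<N}. Q i j}"
      unfolding Q_def by (rule exchange_out_card[OF R' no']) (use j x[OF that] in auto)
    then show ?thesis
      using restrict[OF AN(1) A(2), of "\<lambda>i. Q i j"] n[of j] j large
      unfolding card_inverse by linarith
  qed
  have excl: "\<not> (P i j \<and> Q i j)" if ij: "i \<in> A" "j \<in> B" for i j
  proof
    assume PQ: "P i j \<and> Q i j"
    then obtain z w where "(a j, z) \<in> M i" "z \<notin> insert (y i) ?Y" "(w, b i) \<in> M j" "w \<notin> ?X"
      unfolding P_def Q_def by blast
    moreover have "i < N" "j < N" using ij AN by auto
    ultimately show False
      using no_crossing_exchange[OF R no M] y[OF ij(1)] by (meson less_imp_le)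
  qed
  define s where "s = int (n - N)"
  have s: "s = int n - int N" "s > 0" using large unfolding s_def by auto
  have "s * (2 * s - int N - 1) \<le> (\<Sum>i\<in>A. int (card {j\<in>B. P i j}))"
  proof -
    have "(\<Sum>i\<in>A. 2 * s - int N - 1) \<le> (\<Sum>i\<in>A. int (card {j\<in>B. P i j}))"
      using lowP s by (intro sum_mono) fastforce
    then show ?thesis using A(2) s_def by simp
  qed
  moreover have "s * (2 * s - int N - 1) \<le> (\<Sum>j\<in>B. int (card {i\<in>A. Q i j}))"
  proof -
    have "(\<Sum>j\<in>B. 2 * s - int N - 1) \<le> (\<Sum>j\<in>B. int (card {i\<in>A. Q i j}))"
      using lowQ s by (intro sum_mono) fastforce
    then show ?thesis using B(2) s_def by simp
  qed
  moreover have "(\<Sum>i\<in>A. int (card {j\<in>B. P i j})) + (\<Sum>j\<in>B. int (card {i\<in>A. Q i j})) \<le> s * s"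
    using sum_card_exclusive_le[OF fin excl] unfolding A(2) B(2) s_def
    by (simp flip: of_nat_sum of_nat_add of_nat_mult del: of_nat_diff)
  ultimately have "s * (2 * (2 * s - int N - 1)) \<le> s * s" by (simp add: algebra_simps)
  then have "2 * (2 * s - int N - 1) \<le> s" using s(2) by simp
  then show False using s(1) large by presburger
qed

text \<open>For \<open>k = N + 1\<close> the size condition is exactly \<open>large\<close> in
  \<open>pair_rainbow_extend\<close>, and it passes to smaller \<open>k\<close>.\<close>

lemma pair_rainbow_exists:
  fixes M :: "nat \<Rightarrow> ('a \<times> 'b) set"
  assumes "\<And>i. i < k \<Longrightarrow> pair_matching (M i)" "\<And>i. i < k \<Longrightarrow> n \<le> card (M i)"
    and "5 * k \<le> 3 * n + 2"
  shows "\<exists>a b. pair_rainbow M {..<k} a b"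
  using assms
proof (induction k)
  case 0
  then show ?case by (simp add: pair_rainbow_def)
next
  case (Suc k)
  then obtain a b where "pair_rainbow M {..<k} a b" by fastforce
  then show ?case
    using Suc.prems pair_rainbow_extend[of M k a b n] by (simp add: lessThan_Suc_atMost)
qed

section \<open>Back to hypergraphs\<close>

lemma forces_rainbow_bipartite:
  assumes k: "5 * k \<le> 3 * t + 2"
  shows "forces_rainbow TYPE('v) 2 k t"
  unfolding forces_rainbow_def
proof (intro allI impI)
  fix V :: "'v set" and S E F
  assume "partite_hypergraph 2 V S E \<and>
    (\<forall>i<k. matching_in E (F i) \<and> finite (F i) \<and> card (F i) = t)"
  then have H: "partite_hypergraph 2 V S E"
    and F: "\<And>i. i < k \<Longrightarrow> F i \<subseteq> E \<and> disjoint (F i) \<and> finite (F i) \<and> card (F i) = t"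
    by (auto simp: matching_in_def)
  have two: "{..<2::nat} = {0, 1}" by auto
  have S01: "V = S 0 \<union> S 1" "S 0 \<inter> S 1 = {}"
    using H unfolding partite_hypergraph_def disjoint_family_on_def two by auto
  define l r where "l d = (THE v. v \<in> d \<inter> S 0)" and "r d = (THE v. v \<in> d \<inter> S 1)" for d
  have lr: "d = {l d, r d}" "l d \<in> S 0" "r d \<in> S 1" if "d \<in> E" for d
  proof -
    have dV: "d \<subseteq> V" and "\<exists>!v. v \<in> d \<inter> S 0" "\<exists>!v. v \<in> d \<inter> S 1"
      using H that unfolding partite_hypergraph_def by auto
    then obtain u v where uv: "d \<inter> S 0 = {u}" "d \<inter> S 1 = {v}" by blast
    then have eq: "l d = u" "r d = v" by (simp_all add: l_def r_def)
    have "d = {u, v}" "u \<in> S 0" "v \<in> S 1" using uv dV S01(1) by blast+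
    then show "d = {l d, r d}" "l d \<in> S 0" "r d \<in> S 1" unfolding eq .
  qed
  \<comment> \<open>Both sides live in the type \<open>'v\<close>; disjointness of
    \<open>S 0\<close> and \<open>S 1\<close> excludes the mixed coincidences
    \<open>l d = r d'\<close>.\<close>
  have disj: "d \<inter> d' = {} \<longleftrightarrow> l d \<noteq> l d' \<and> r d \<noteq> r d'" if "d \<in> E" "d' \<in> E" for d d'
  proof -
    have "l d \<noteq> r d'" "r d \<noteq> l d'"
      using lr(2,3)[OF that(1)] lr(2,3)[OF that(2)] S01(2) by (metis IntI empty_iff)+
    moreover have eq: "d \<inter> d' = {l d, r d} \<inter> {l d', r d'}"
      by (rule arg_cong2[where f = "(\<inter>)"]) (rule lr(1), fact)+
    ultimately show ?thesis unfolding eq by auto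
  qed
  have inj: "inj_on l (F i)" "inj_on r (F i)" if "i < k" for i
  proof -
    have "d = d'" if "d \<in> F i" "d' \<in> F i" "l d = l d' \<or> r d = r d'" for d d'
    proof (rule ccontr)
      assume "d \<noteq> d'"
      then have "d \<inter> d' = {}"
        using F[OF \<open>i < k\<close>] that(1,2) unfolding disjoint_def by blast
      moreover have "d \<in> E" "d' \<in> E" using F[OF \<open>i < k\<close>] that(1,2) by blast+
      ultimately show False using disj that(3) by simp
    qed
    then show "inj_on l (F i)" "inj_on r (F i)" by (auto intro: inj_onI)
  qed
  define M where "M i = (\<lambda>d. (l d, r d)) ` F i" for i
  have "pair_matching (M i)" if "i < k" for i
    unfolding pair_matching_def M_def
    using F[OF that] inj[OF that] by (auto simp: inj_on_def)
  moreover have "t \<le> card (M i)" if "i < k" for i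
  proof -
    have "inj_on (\<lambda>d. (l d, r d)) (F i)"
      using inj[OF that] unfolding inj_on_def by blast
    then show ?thesis using F[OF that] by (simp add: M_def card_image)
  qed
  ultimately obtain a b where R: "pair_rainbow M {..<k} a b"
    using pair_rainbow_exists[OF _ _ k] by blast
  then have "\<forall>i<k. \<exists>d. d \<in> F i \<and> l d = a i \<and> r d = b i"
    unfolding pair_rainbow_def M_def by (fastforce simp: image_iff)
  then obtain e where e: "\<And>i. i < k \<Longrightarrow> e i \<in> F i \<and> l (e i) = a i \<and> r (e i) = b i" by metis
  have "e i \<inter> e j = {}" if "i < k" "j < k" "i \<noteq> j" for i j
  proof -
    have "e i \<in> E" "e j \<in> E" using e F that by blast+
    moreover have "a i \<noteq> a j" "b i \<noteq> b j"
      using R that unfolding pair_rainbow_def inj_on_def by auto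
    ultimately show ?thesis using disj e that by simp
  qed
  then show "\<exists>e. rainbow_matching k F e"
    using e unfolding rainbow_matching_def by blast
qed

theorem theorem1p12:
  fixes k :: nat
  assumes "k \<ge> 1"
  shows "real (rainbow_number 2 k) \<le> 7 / 4 * real k"
proof -
  \<comment> \<open>Since \<open>7 * k div 4\<close> is at least (7k - 3)/4, the right side is at
    least (21k - 1)/4, which is at least 5k for k \<ge> 1.\<close>
  have "5 * k \<le> 3 * (7 * k div 4) + 2" using assms by linarith
  then have "rainbow_number 2 k \<le> 7 * k div 4"
    unfolding rainbow_number_def by (intro Least_le forces_rainbow_bipartite)
  then have "4 * rainbow_number 2 k \<le> 7 * k" by linarith
  then show ?thesis by linarith
qed

end
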